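(* Every nonempty $\tau_{\mathbb{Q}}$-open subset of $\mathbb{R}$ is nonmeager and has positive outer Lebesgue measure (nonmeager in the usual topology of $\mathbb{R}$). Consequently the same is true for every nonempty $\tau_{\mathcal{H}}$-open subset of $\mathbb{R}$.
   Context: The topology $\tau_{\mathbb{Q}}$ on $\mathbb{R}$: a set $U\subseteq\mathbb{R}$ is $\tau_{\mathbb{Q}}$-open iff for every $a\in U$ and every real $x\neq0$ there is $\varepsilon(a,x)>0$ such that $a+qx\in U$ for all $q\in\mathbb{Q}$ with $0<q<\varepsilon(a,x)$. A function $H:\mathbb{R}\to\mathbb{R}$ is additive if $H(x+y)=H(x)+H(y)$ for all $x,y$. $\tau_{\mathcal{H}}$ is the initial topology on $\mathbb{R}$ generated by all additive functions, i.e. the smallest topology making every additive $H$ continuous as a map from $(\mathbb{R},\tau_{\mathcal{H}})$ to $\mathbb{R}$ with the usual topology. *)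

theory Defs
  imports "HOL-Analysis.Analysis"
begin

definition nowhere_dense :: "'a::topological_space set \<Rightarrow> bool"
  where "nowhere_dense A \<longleftrightarrow> interior (closure A) = {}"

definition meager :: "'a::topological_space set \<Rightarrow> bool"
  where "meager A \<longleftrightarrow> (\<exists>\<F>. countable \<F> \<and> (\<forall>N\<in>\<F>. nowhere_dense N) \<and> A = \<Union>\<F>)"

definition tau_Q_open :: "real set \<Rightarrow> bool"
  where "tau_Q_open U \<longleftrightarrow>
    (\<forall>a\<in>U. \<forall>x. x \<noteq> 0 \<longrightarrow> (\<exists>\<epsilon>>0. \<forall>q\<in>\<rat>. 0 < q \<and> q < \<epsilon> \<longrightarrow> a + q * x \<in> U))"

definition tau_Q :: "real topology"
  where "tau_Q = topology tau_Q_open"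

lemma istopology_tau_Q_open: "istopology tau_Q_open"
  unfolding istopology_def
proof (intro conjI allI impI)
  fix S T assume S: "tau_Q_open S" and T: "tau_Q_open T"
  show "tau_Q_open (S \<inter> T)"
    unfolding tau_Q_open_def
  proof (intro ballI allI impI)
    fix a x :: real assume a: "a \<in> S \<inter> T" and x: "x \<noteq> 0"
    obtain d where d: "d > 0" "\<forall>q\<in>\<rat>. 0 < q \<and> q < d \<longrightarrow> a + q * x \<in> S"
      using S a x unfolding tau_Q_open_def by blast
    obtain e where e: "e > 0" "\<forall>q\<in>\<rat>. 0 < q \<and> q < e \<longrightarrow> a + q * x \<in> T"
      using T a x unfolding tau_Q_open_def by blast
    show "\<exists>\<epsilon>>0. \<forall>q\<in>\<rat>. 0 < q \<and> q < \<epsilon> \<longrightarrow> a + q * x \<in> S \<inter> T"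
      using d e by (intro exI[of _ "min d e"]) auto
  qed
next
  fix \<K> assume K: "\<forall>K\<in>\<K>. tau_Q_open K"
  show "tau_Q_open (\<Union>\<K>)"
    unfolding tau_Q_open_def
  proof (intro ballI allI impI)
    fix a x :: real assume "a \<in> \<Union>\<K>" and x: "x \<noteq> 0"
    then obtain K where "K \<in> \<K>" "a \<in> K" by blast
    then obtain e where "e > 0" "\<forall>q\<in>\<rat>. 0 < q \<and> q < e \<longrightarrow> a + q * x \<in> K"
      using K x unfolding tau_Q_open_def by blast
    then show "\<exists>\<epsilon>>0. \<forall>q\<in>\<rat>. 0 < q \<and> q < \<epsilon> \<longrightarrow> a + q * x \<in> \<Union>\<K>"
      using \<open>K \<in> \<K>\<close> by blast
  qed
qed

lemma openin_tau_Q: "openin tau_Q U \<longleftrightarrow> tau_Q_open U"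
  by (simp add: tau_Q_def topology_inverse' istopology_tau_Q_open)

text \<open>The initial topology is generated by the preimages of the usual open sets; the three
  lemmas below confirm that it is the smallest topology on the whole line making every additive
  function continuous.\<close>

definition tau_H :: "real topology"
  where "tau_H = topology_generated_by
    {H -` V | H V. Modules.additive (H :: real \<Rightarrow> real) \<and> open V}"

lemma topspace_tau_H: "topspace tau_H = UNIV"
proof -
  have "Modules.additive (\<lambda>x::real. x)" by unfold_locales simp
  then have "(\<lambda>x::real. x) -` UNIV \<in> {H -` V | H V. Modules.additive (H :: real \<Rightarrow> real) \<and> open V}"
    by blast
  then have "openin tau_H ((\<lambda>x::real. x) -` UNIV)"
    unfolding tau_H_def by (rule topology_generated_by_Basis)
  then show ?thesis
    using openin_subset by fastforce
qed

lemma continuous_map_tau_H: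
  fixes H :: "real \<Rightarrow> real"
  assumes "Modules.additive H"
  shows "continuous_map tau_H euclidean H"
proof -
  have "openin tau_H (H -` V)" if "open V" for V
    unfolding tau_H_def by (rule topology_generated_by_Basis) (use assms that in blast)
  then show ?thesis
    by (simp add: continuous_map_def topspace_tau_H vimage_def)
qed

lemma tau_H_smallest:
  fixes T :: "real topology"
  assumes "topspace T = UNIV"
    and "\<And>H :: real \<Rightarrow> real. Modules.additive H \<Longrightarrow> continuous_map T euclidean H"
    and "openin tau_H U"
  shows "openin T U"
proof (rule generate_topology_on_coarsest)
  show "istopology (openin T)" by simp
  show "generate_topology_on {H -` V | H V. Modules.additive (H :: real \<Rightarrow> real) \<and> open V} U"
    using assms(3) unfolding tau_H_def by (rule openin_topology_generated_by)
  show "openin T S"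
    if S: "S \<in> {H -` V | H V. Modules.additive (H :: real \<Rightarrow> real) \<and> open V}" for S
  proof -
    obtain H :: "real \<Rightarrow> real" and V where "S = H -` V" "Modules.additive H" "open V"
      using S by blast
    then show ?thesis
      using assms(1) assms(2)[of H] by (simp add: continuous_map_def vimage_def)
  qed
qed

end

theory Submission
  imports Defs
begin

text \<open>
  Around each of its points \<open>a\<close>, a \<open>\<tau>\<^sub>Q\<close>-open set \<open>U\<close> is absorbing along the harmonic sequence:
  for every real \<open>y\<close>, the points \<open>a + y / m\<close> lie in \<open>U\<close> for all large natural numbers \<open>m\<close>.
  Consequently the countably many magnified copies \<open>m \<cdot> (U - a)\<close> cover the whole line
  (\<open>tau_Q_open_magnifications_cover\<close>). Homeomorphisms preserve meagerness, affine maps preserve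
  negligibility, and both kinds of smallness pass to countable unions; so if \<open>U\<close> were meager or
  null, the line itself would be, which contradicts the Baire category theorem or the infinite
  measure of the line, respectively.

  An additive function \<open>H\<close> is linear over the rationals, hence \<open>H (a + q * x)\<close> is
  an affine function of the rational parameter \<open>q\<close>. Continuity of affine functions at \<open>q = 0\<close> is
  all that \<open>\<tau>\<^sub>Q\<close> tests, so \<open>H\<close> is continuous for \<open>\<tau>\<^sub>Q\<close>. Hence
  \<open>\<tau>\<^sub>H\<close> is coarser than \<open>\<tau>\<^sub>Q\<close> and its open sets inherit the result.
\<close>

lemma not_meager_UNIV: "\<not> meager (UNIV :: 'a::{real_normed_vector,heine_borel} set)"
proof
  assume "meager (UNIV :: 'a set)"
  then obtain \<F> :: "'a set set" where \<F>: "countable \<F>" "\<And>N. N \<in> \<F> \<Longrightarrow> nowhere_dense N" "UNIV = \<Union>\<F>"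
    unfolding meager_def by blast
  have "UNIV \<subseteq> closure (\<Inter>N\<in>\<F>. - closure N)"
  proof (rule Baire)
    fix T assume "T \<in> (\<lambda>N. - closure N) ` \<F>"
    then show "openin (top_of_set UNIV) T \<and> UNIV \<subseteq> closure T"
      using \<F>(2) by (auto simp: nowhere_dense_def closure_complement)
  qed (use \<F>(1) in auto)
  moreover have "(\<Inter>N\<in>\<F>. - closure N) = {}"
  proof -
    have "x \<notin> (\<Inter>N\<in>\<F>. - closure N)" for x
    proof -
      obtain N where "N \<in> \<F>" "x \<in> N"
        using \<F>(3) by (metis UNIV_I UnionE)
      then show ?thesis
        using closure_subset by blast
    qed
    then show ?thesis
      by (metis all_not_in_conv)
  qed
  ultimately show False
    by simp
qed

lemma meager_UNION:
  assumes "countable I" and "\<And>i. i \<in> I \<Longrightarrow> meager (A i)"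
  shows "meager (\<Union>i\<in>I. A i)"
proof -
  have "\<forall>i\<in>I. \<exists>\<F>. countable \<F> \<and> (\<forall>N\<in>\<F>. nowhere_dense N) \<and> A i = \<Union>\<F>"
    using assms(2) unfolding meager_def by blast
  then obtain \<F> where \<F>: "\<And>i. i \<in> I \<Longrightarrow> countable (\<F> i) \<and> (\<forall>N\<in>\<F> i. nowhere_dense N) \<and> A i = \<Union>(\<F> i)"
    by metis
  have "countable (\<Union>i\<in>I. \<F> i)"
    using assms(1) \<F> by blast
  moreover have "\<forall>N\<in>(\<Union>i\<in>I. \<F> i). nowhere_dense N"
    using \<F> by blast
  moreover have "(\<Union>i\<in>I. A i) = \<Union>(\<Union>i\<in>I. \<F> i)"
    using \<F> by auto
  ultimately show ?thesis
    unfolding meager_def by blast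
qed

lemma nowhere_dense_homeomorphic_image:
  assumes "homeomorphic_map euclidean euclidean f" and "nowhere_dense N"
  shows "nowhere_dense (f ` N)"
  using homeomorphic_map_closure_of[OF assms(1), of N]
    homeomorphic_map_interior_of[OF assms(1), of "closure N"] assms(2)
  by (simp add: nowhere_dense_def)

lemma meager_homeomorphic_image:
  assumes "homeomorphic_map euclidean euclidean f" and "meager A"
  shows "meager (f ` A)"
proof -
  obtain \<F> where \<F>: "countable \<F>" "\<forall>N\<in>\<F>. nowhere_dense N" "A = \<Union>\<F>"
    using assms(2) unfolding meager_def by blast
  have "\<forall>N\<in>(`) f ` \<F>. nowhere_dense N"
    using \<F>(2) nowhere_dense_homeomorphic_image[OF assms(1)] by blast
  moreover have "f ` A = \<Union>((`) f ` \<F>)"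
    using \<F>(3) by blast
  ultimately show ?thesis
    unfolding meager_def using \<F>(1) by blast
qed

lemma outer_measure_of_lebesgue_eq_0_imp_negligible:
  fixes A :: "'a::euclidean_space set"
  assumes "outer_measure_of lebesgue A = 0"
  shows "negligible A"
proof -
  obtain E where "E \<in> sets lebesgue" "A \<subseteq> E" "outer_measure_of lebesgue A = emeasure lebesgue E"
    using outer_measure_of_attain[of A lebesgue] by auto
  then show ?thesis
    using assms negligible_iff_emeasure0 negligible_subset by metis
qed

text \<open>Given \<open>y\<close>, the definition of \<open>\<tau>\<^sub>Q\<close>-openness is applied in the direction \<open>y\<close> itself, with the
  rational parameter \<open>q = 1 / m\<close>. The magnification factor is then a natural number, however
  \<open>y\<close> is chosen, and this is what makes the cover countable.\<close>

lemma tau_Q_open_magnifications_cover: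
  assumes "tau_Q_open U" and "a \<in> U"
  shows "(\<Union>n. (\<lambda>z. real (Suc n) * (z - a)) ` U) = UNIV"
proof -
  have "\<exists>n. y \<in> (\<lambda>z. real (Suc n) * (z - a)) ` U" for y
  proof -
    have "\<exists>n. a + inverse (real (Suc n)) * y \<in> U"
    proof (cases "y = 0")
      case True
      then show ?thesis
        using assms(2) by simp
    next
      case False
      then obtain e where e: "e > 0" "\<And>q. q \<in> \<rat> \<Longrightarrow> 0 < q \<Longrightarrow> q < e \<Longrightarrow> a + q * y \<in> U"
        using assms unfolding tau_Q_open_def by blast
      obtain n where "inverse (real (Suc n)) < e"
        using reals_Archimedean[OF e(1)] by blast
      then show ?thesis
        using e(2)[of "inverse (real (Suc n))"] by auto
    qed
    then obtain n where n: "a + inverse (real (Suc n)) * y \<in> U" by blast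
    have "y = real (Suc n) * ((a + inverse (real (Suc n)) * y) - a)"
      by (simp del: of_nat_Suc)
    then show ?thesis
      using n by blast
  qed
  then show ?thesis
    by auto
qed

lemma homeomorphic_map_magnification:
  fixes a c :: real
  assumes "c \<noteq> 0"
  shows "homeomorphic_map euclidean euclidean (\<lambda>z. c * (z - a))"
proof (rule homeomorphic_maps_imp_map)
  show "homeomorphic_maps euclidean euclidean (\<lambda>z. c * (z - a)) (\<lambda>y. a + y / c)"
    using assms by (auto simp: homeomorphic_maps_def intro!: continuous_intros)
qed

lemma tau_Q_open_not_meager:
  assumes "tau_Q_open U" and "U \<noteq> {}"
  shows "\<not> meager U"
proof
  assume U: "meager U"
  obtain a where a: "a \<in> U"
    using assms(2) by blast
  have "meager (\<Union>n. (\<lambda>z. real (Suc n) * (z - a)) ` U)"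
    by (intro meager_UNION meager_homeomorphic_image homeomorphic_map_magnification U) auto
  then show False
    using not_meager_UNIV unfolding tau_Q_open_magnifications_cover[OF assms(1) a] by blast
qed

lemma tau_Q_open_outer_measure_pos:
  assumes "tau_Q_open U" and "U \<noteq> {}"
  shows "outer_measure_of lebesgue U > 0"
proof (rule ccontr)
  assume "\<not> outer_measure_of lebesgue U > 0"
  then have U: "negligible U"
    by (intro outer_measure_of_lebesgue_eq_0_imp_negligible) (simp add: not_less)
  obtain a where a: "a \<in> U"
    using assms(2) by blast
  have "negligible ((\<lambda>z. real (Suc n) * (z - a)) ` U)" for n
    by (rule negligible_differentiable_image_negligible[OF _ U])
      (auto simp del: of_nat_Suc intro!: differentiable_on_mult differentiable_on_diff)
  then have "negligible (\<Union>n. (\<lambda>z. real (Suc n) * (z - a)) ` U)"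
    by (intro negligible_countable_Union) auto
  then show False
    unfolding tau_Q_open_magnifications_cover[OF assms(1) a] by simp
qed

lemma additive_rational_mult:
  fixes H :: "real \<Rightarrow> real"
  assumes "Modules.additive H" and "q \<in> \<rat>"
  shows "H (q * x) = q * H x"
proof -
  interpret H: Modules.additive H by (rule assms(1))
  have nat: "H (real n * y) = real n * H y" for n y
    by (induction n) (simp_all add: H.zero H.add distrib_right)
  have int: "H (real_of_int i * y) = real_of_int i * H y" for i y
    by (cases i rule: int_cases2) (simp_all add: nat H.minus)
  obtain i n where q: "q = real_of_int i / real n" "n \<noteq> 0"
    using assms(2) unfolding Rats_eq_int_div_nat by blast
  have "real n * H (q * x) = H (real n * (q * x))"
    by (simp add: nat)
  also have "\<dots> = H (real_of_int i * x)"
    using q by simp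
  also have "\<dots> = real n * (q * H x)"
    using q by (simp add: int)
  finally show ?thesis
    using q(2) by simp
qed

text \<open>\<open>H\<close> may be discontinuous for the usual topology, but for rational \<open>q\<close> the value \<open>H (a + q * x)\<close>
  agrees with \<open>H a + q * H x\<close>, which is continuous in the real parameter \<open>q\<close> and so stays
  in \<open>V\<close> for small \<open>q\<close>.\<close>

lemma tau_Q_open_additive_vimage:
  fixes H :: "real \<Rightarrow> real"
  assumes H: "Modules.additive H" and V: "open V"
  shows "tau_Q_open (H -` V)"
  unfolding tau_Q_open_def
proof (intro ballI allI impI)
  fix a x :: real
  assume a: "a \<in> H -` V"
  have "((\<lambda>q. H a + q * H x) \<longlongrightarrow> H a + 0 * H x) (at_right 0)"
    by (intro tendsto_intros)
  then have "eventually (\<lambda>q. H a + q * H x \<in> V) (at_right 0)"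
    using a V by (auto dest: topological_tendstoD)
  then obtain e where e: "e > 0" "\<And>q. 0 < q \<Longrightarrow> q < e \<Longrightarrow> H a + q * H x \<in> V"
    unfolding eventually_at_right_field by blast
  moreover have "H (a + q * x) = H a + q * H x" if "q \<in> \<rat>" for q
    using H that by (simp add: additive.add additive_rational_mult)
  ultimately show "\<exists>\<epsilon>>0. \<forall>q\<in>\<rat>. 0 < q \<and> q < \<epsilon> \<longrightarrow> a + q * x \<in> H -` V"
    by auto
qed

lemma openin_tau_H_imp_tau_Q_open:
  assumes "openin tau_H U"
  shows "tau_Q_open U"
proof -
  have "tau_Q_open UNIV"
    by (auto simp: tau_Q_open_def intro: zero_less_one)
  then have top: "topspace tau_Q = UNIV"
    using openin_subset[of tau_Q UNIV] by (simp add: openin_tau_Q top.extremum_unique)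
  have "continuous_map tau_Q euclidean H" if "Modules.additive H" for H :: "real \<Rightarrow> real"
    using tau_Q_open_additive_vimage[OF that]
    by (auto simp: continuous_map_def top openin_tau_Q vimage_def)
  then have "openin tau_Q U"
    using tau_H_smallest[OF top _ assms] by blast
  then show ?thesis
    by (simp add: openin_tau_Q)
qed

theorem theorem7p1:
  shows "(\<forall>U. openin tau_Q U \<and> U \<noteq> {} \<longrightarrow> \<not> meager U \<and> outer_measure_of lebesgue U > 0)
    \<and> (\<forall>U. openin tau_H U \<and> U \<noteq> {} \<longrightarrow> \<not> meager U \<and> outer_measure_of lebesgue U > 0)"
  using tau_Q_open_not_meager tau_Q_open_outer_measure_pos openin_tau_H_imp_tau_Q_open
  unfolding openin_tau_Q by blast

end
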